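(* Let $f,\nu:\mathbb{Z}^2\to\mathbb{R}^4\setminus\{0\}$ satisfy $\langle f,\nu\rangle=0$ and be related by the discrete projective Lelieuvre map, i.e. $f\wedge f_1=\star(\nu\wedge\nu_1)$ and $f\wedge f_2=-\star(\nu\wedge\nu_2)$ on $\mathbb{Z}^2$. Assume that $\det|\nu,\nu_1,\nu_2,\nu_{12}|\neq0$ everywhere on $\mathbb{Z}^2$. Then there exist functions $B_1,B_2,\tilde B_1,\tilde B_2:\mathbb{Z}^2\to\mathbb{R}$ such that $$\nu_{11}=A_1\nu_{12}+B_1\nu_1+C_1\nu,\qquad \nu_{22}=A_2\nu_{12}+B_2\nu_2+C_2\nu$$ and $$f_{11}=-A_1f_{12}+\tilde B_1f_1+C_1f,\qquad f_{22}=-A_2f_{12}+\tilde B_2f_2+C_2f,$$ where $$A_1=-\frac{\langle f_{11},\nu\rangle}{\langle f_{12},\nu\rangle},\quad C_1=\frac{\langle f_{11},\nu_{12}\rangle}{\langle f_{12},\nu\rangle},\quad A_2=-\frac{\langle f_{22},\nu\rangle}{\langle f_{12},\nu\rangle},\quad C_2=\frac{\langle f_{22},\nu_{12}\rangle}{\langle f_{12},\nu\rangle}.$$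
   Context: $f$ and $\nu$ are homogeneous coordinate vectors of discrete surfaces in $P^3$ and in the dual space $P_3$, depending on integers $(n_1,n_2)$. Subscripts on $f$ and $\nu$ denote shifts, not components: $f_1(n_1,n_2)=f(n_1+1,n_2)$, $f_2(n_1,n_2)=f(n_1,n_2+1)$, $f_{11}(n_1,n_2)=f(n_1+2,n_2)$, $f_{12}(n_1,n_2)=f(n_1+1,n_2+1)$, $f_{22}(n_1,n_2)=f(n_1,n_2+2)$, and similarly for $\nu$. $\langle a,b\rangle=\sum_{i=1}^4a_ib_i$ for vectors $a,b\in\mathbb{R}^4$. $\varepsilon$ is the totally alternating symbol with $\varepsilon_{1234}=1$; for vectors $a,b\in\mathbb{R}^4$ with components $a_i,b_i$, $(a\wedge b)_{ik}=a_ib_k-a_kb_i$; for a skew-symmetric $T$, $(\star T)_{ik}=\frac12\sum_{l,m}\varepsilon_{lmik}T_{lm}$. Hence $(\star(a\wedge b))_{ik}=\sum_{l,m}\varepsilon_{iklm}a_lb_m$. $\det|a,b,c,d|$ is the determinant of the matrix formed by the four vectors. *)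

theory Defs
  imports "HOL-Analysis.Analysis"
begin

(* The map 1 -> i, 2 -> k, 3 -> l, 4 -> m. The type 4 has the elements 1, 2, 3 and 4, and 4 = 0. *)
definition index_tuple :: "4 \<Rightarrow> 4 \<Rightarrow> 4 \<Rightarrow> 4 \<Rightarrow> 4 \<Rightarrow> 4" where
  "index_tuple i k l m = (\<lambda>j. if j = 1 then i else if j = 2 then k else if j = 3 then l else m)"

definition levi_civita :: "4 \<Rightarrow> 4 \<Rightarrow> 4 \<Rightarrow> 4 \<Rightarrow> real" where
  "levi_civita i k l m =
     (if bij (index_tuple i k l m) then of_int (sign (index_tuple i k l m)) else 0)"

definition wedge :: "real^4 \<Rightarrow> real^4 \<Rightarrow> real^4^4" where
  "wedge a b = (\<chi> i k. a $ i * b $ k - a $ k * b $ i)"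

(* Meant for skew-symmetric T. On wedge products see hodge_wedge below. *)
definition hodge :: "real^4^4 \<Rightarrow> real^4^4" where
  "hodge T = (\<chi> i k. 1 / 2 * (\<Sum>l\<in>UNIV. \<Sum>m\<in>UNIV. levi_civita l m i k * T $ l $ m))"

definition shift1 :: "(int \<Rightarrow> int \<Rightarrow> 'a) \<Rightarrow> int \<Rightarrow> int \<Rightarrow> 'a" where
  "shift1 g n1 n2 = g (n1 + 1) n2"

definition shift2 :: "(int \<Rightarrow> int \<Rightarrow> 'a) \<Rightarrow> int \<Rightarrow> int \<Rightarrow> 'a" where
  "shift2 g n1 n2 = g n1 (n2 + 1)"

abbreviation shift11 :: "(int \<Rightarrow> int \<Rightarrow> 'a) \<Rightarrow> int \<Rightarrow> int \<Rightarrow> 'a" where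
  "shift11 g \<equiv> shift1 (shift1 g)"

abbreviation shift12 :: "(int \<Rightarrow> int \<Rightarrow> 'a) \<Rightarrow> int \<Rightarrow> int \<Rightarrow> 'a" where
  "shift12 g \<equiv> shift1 (shift2 g)"

abbreviation shift22 :: "(int \<Rightarrow> int \<Rightarrow> 'a) \<Rightarrow> int \<Rightarrow> int \<Rightarrow> 'a" where
  "shift22 g \<equiv> shift2 (shift2 g)"

definition lelieuvre_related ::
  "(int \<Rightarrow> int \<Rightarrow> real^4) \<Rightarrow> (int \<Rightarrow> int \<Rightarrow> real^4) \<Rightarrow> bool" where
  "lelieuvre_related f \<nu> \<longleftrightarrow>
     (\<forall>n1 n2. wedge (f n1 n2) (shift1 f n1 n2) = hodge (wedge (\<nu> n1 n2) (shift1 \<nu> n1 n2)) \<and>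
              wedge (f n1 n2) (shift2 f n1 n2) = - hodge (wedge (\<nu> n1 n2) (shift2 \<nu> n1 n2)))"

lemma levi_civita_1234: "levi_civita 1 2 3 4 = 1"
proof -
  have "index_tuple 1 2 3 4 = id"
    by (simp add: fun_eq_iff forall_4 index_tuple_def)
  then show ?thesis by (simp add: levi_civita_def sign_id)
qed

lemma levi_civita_compose:
  assumes "a \<noteq> b"
  shows "index_tuple i' k' l' m' = index_tuple i k l m \<circ> Transposition.transpose a b \<Longrightarrow>
    levi_civita i' k' l' m' = - levi_civita i k l m"
proof -
  assume eq: "index_tuple i' k' l' m' = index_tuple i k l m \<circ> Transposition.transpose a b"
  have b: "bij (index_tuple i' k' l' m') \<longleftrightarrow> bij (index_tuple i k l m)"
    unfolding eq by (metis bij_comp bij_transpose comp_assoc comp_id transpose_comp_involutory)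
  show ?thesis
  proof (cases "bij (index_tuple i k l m)")
    case True
    then have "permutation (index_tuple i k l m)"
      by (simp add: permutation finite)
    then have "sign (index_tuple i' k' l' m') = - sign (index_tuple i k l m)"
      unfolding eq using assms by (simp add: sign_compose permutation_swap_id sign_swap_id)
    then show ?thesis using True b by (simp add: levi_civita_def)
  qed (simp add: levi_civita_def b)
qed

lemma levi_civita_alternating:
  "levi_civita k i l m = - levi_civita i k l m"
  "levi_civita i l k m = - levi_civita i k l m"
  "levi_civita i k m l = - levi_civita i k l m"
  by (rule levi_civita_compose[of 1 2] levi_civita_compose[of 2 3] levi_civita_compose[of 3 4];
      simp add: fun_eq_iff forall_4 index_tuple_def Transposition.transpose_def)+

lemma hodge_wedge:
  "hodge (wedge a b) $ i $ k = (\<Sum>l\<in>UNIV. \<Sum>m\<in>UNIV. levi_civita i k l m * a $ l * b $ m)"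
proof -
  have e: "levi_civita l m i k = levi_civita i k l m" for l m
    by (metis levi_civita_alternating minus_minus)
  have "(\<Sum>l\<in>UNIV. \<Sum>m\<in>UNIV. levi_civita i k l m * (a $ m * b $ l)) =
        - (\<Sum>l\<in>UNIV. \<Sum>m\<in>UNIV. levi_civita i k l m * (a $ l * b $ m))"
    by (subst sum.swap, subst levi_civita_alternating(3)) (simp add: sum_negf)
  then show ?thesis
    by (simp add: hodge_def wedge_def e right_diff_distrib sum_subtractf mult.assoc)
qed

end

theory Submission
  imports Defs
begin

text \<open>
  Contracting the Lelieuvre relations with two vectors $x, y$ turns them into scalar identities
  $\langle f, x\rangle \langle f_1, y\rangle - \langle f, y\rangle \langle f_1, x\rangle
  = \det|\nu, \nu_1, x, y|$. They show that each vertex of one surface is orthogonal to its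
  lattice neighbours on the other. Hence $\langle f_1, \cdot\rangle$ kills the $\nu_2$-component of
  $\nu_{11}$ in the basis $\nu, \nu_1, \nu_2, \nu_{12}$, and contracting the relation for
  $f_1 \wedge f_{11}$ with $(\nu, \nu_2)$ and $(\nu_2, \nu_{12})$ gives its $\nu_{12}$- and
  $\nu$-components. The equation for $f_{11}$ is then checked against that basis. Exchanging the two
  lattice directions only changes the sign of the relations.
\<close>

lemma vector_4:
  "(vector [a, b, c, d] :: 'a::zero^4) $ 1 = a"
  "(vector [a, b, c, d] :: 'a^4) $ 2 = b"
  "(vector [a, b, c, d] :: 'a^4) $ 3 = c"
  "(vector [a, b, c, d] :: 'a^4) $ 4 = d"
  unfolding vector_def by simp_all

lemma prod_4: "prod g (UNIV :: 4 set) = g 1 * g 2 * g 3 * g 4"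
  unfolding UNIV_4 by (simp add: ac_simps)

text \<open>The Leibniz formula, with the sum over permutations turned into a sum over all index
  quadruples: a permutation \<open>p\<close> corresponds to \<open>(p 1, p 2, p 3, p 4)\<close>, and
  on the remaining quadruples \<open>levi_civita\<close> vanishes. This form can be compared with
  \<open>hodge_wedge\<close> term by term.\<close>

lemma det_vector_4:
  fixes a b c d :: "real^4"
  shows "det (vector [a, b, c, d] :: real^4^4) =
    (\<Sum>i\<in>UNIV. \<Sum>k\<in>UNIV. \<Sum>l\<in>UNIV. \<Sum>m\<in>UNIV. levi_civita i k l m * (a $ i * b $ k * c $ l * d $ m))"
proof -
  define g where "g = (\<lambda>(i, k, l, m). levi_civita i k l m * (a $ i * b $ k * c $ l * d $ m))"
  define S where "S = {(i, k, l, m). bij (index_tuple i k l m)}"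
  have tuple: "index_tuple (p 1) (p 2) (p 3) (p 4) = p" for p
    by (simp add: fun_eq_iff forall_4 index_tuple_def)
  have entries: "index_tuple i k l m 1 = i" "index_tuple i k l m 2 = k" "index_tuple i k l m 3 = l"
    "index_tuple i k l m 4 = m" for i k l m
    by (simp_all add: index_tuple_def)
  have "det (vector [a, b, c, d] :: real^4^4) = sum g S"
    unfolding det_def
    by (rule sum.reindex_bij_witness[where
          j = "\<lambda>p. (p 1, p 2, p 3, p 4)" and i = "\<lambda>(i, k, l, m). index_tuple i k l m"])
      (auto simp: S_def g_def tuple permutes_bij levi_civita_def prod_4 vector_4
        entries intro: bij_imp_permutes)
  also have "\<dots> = sum g UNIV"
    by (rule sum.mono_neutral_left) (auto simp: S_def g_def levi_civita_def split: if_splits)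
  also have "\<dots> = (\<Sum>i\<in>UNIV. \<Sum>k\<in>UNIV. \<Sum>l\<in>UNIV. \<Sum>m\<in>UNIV. g (i, k, l, m))"
    by (simp add: sum.cartesian_product)
  finally show ?thesis by (simp add: g_def)
qed

lemma det_vector_4_swap:
  fixes a b c d :: "real^4"
  shows "det (vector [b, a, c, d] :: real^4^4) = - det (vector [a, b, c, d] :: real^4^4)"
    and "det (vector [a, c, b, d] :: real^4^4) = - det (vector [a, b, c, d] :: real^4^4)"
    and "det (vector [a, b, d, c] :: real^4^4) = - det (vector [a, b, c, d] :: real^4^4)"
proof -
  have swap: "det B = - det A"
    if "i \<noteq> j" "B = (\<chi> k. A $ Transposition.transpose i j k)" for A B :: "real^4^4" and i j
    using that det_permute_rows[OF permutes_swap_id[of i UNIV j], of A] by (simp add: sign_swap_id)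
  show "det (vector [b, a, c, d] :: real^4^4) = - det (vector [a, b, c, d] :: real^4^4)"
    by (rule swap[of 1 2]) (simp_all add: vec_eq_iff forall_4 vector_4 Transposition.transpose_def)
  show "det (vector [a, c, b, d] :: real^4^4) = - det (vector [a, b, c, d] :: real^4^4)"
    by (rule swap[of 2 3]) (simp_all add: vec_eq_iff forall_4 vector_4 Transposition.transpose_def)
  show "det (vector [a, b, d, c] :: real^4^4) = - det (vector [a, b, c, d] :: real^4^4)"
    by (rule swap[of 3 4]) (simp_all add: vec_eq_iff forall_4 vector_4 Transposition.transpose_def)
qed

lemma det_vector_4_repeated:
  fixes a b c :: "real^4"
  shows "det (vector [a, b, a, c] :: real^4^4) = 0"
    and "det (vector [b, a, a, c] :: real^4^4) = 0"
    and "det (vector [b, a, c, a] :: real^4^4) = 0"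
    and "det (vector [a, b, c, a] :: real^4^4) = 0"
  using det_vector_4_swap(1)[of a a b c] det_vector_4_swap(2)[of a a b c]
    det_vector_4_swap(2)[of b a a c] det_vector_4_swap(3)[of b a a c]
    det_vector_4_swap(3)[of a b a c]
  by simp_all

lemma det_vector_4_linear:
  "linear (\<lambda>d. det (vector [a, b, c, d] :: real^4^4))"
  by (rule linearI) (simp_all add: det_vector_4 algebra_simps sum.distrib sum_distrib_left)

lemma inner_wedge:
  "x \<bullet> (wedge a b *v y) = (a \<bullet> x) * (b \<bullet> y) - (a \<bullet> y) * (b \<bullet> x)"
  by (simp add: wedge_def matrix_vector_mult_def inner_vec_def sum_4 algebra_simps)

lemma inner_hodge_wedge:
  "x \<bullet> (hodge (wedge a b) *v y) = det (vector [a, b, x, y] :: real^4^4)"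
proof -
  have "x \<bullet> (hodge (wedge a b) *v y) = det (vector [x, y, a, b] :: real^4^4)"
    by (simp add: det_vector_4 matrix_vector_mult_def inner_vec_def hodge_wedge
        sum_distrib_left sum_distrib_right ac_simps)
  \<comment> \<open>Moving the pair \<open>a, b\<close> past \<open>x, y\<close> takes four adjacent
    transpositions, so the sign is unchanged.\<close>
  also have "\<dots> = det (vector [a, b, x, y] :: real^4^4)"
    using det_vector_4_swap(2)[of x y a b] det_vector_4_swap(1)[of x a y b]
      det_vector_4_swap(3)[of a x y b] det_vector_4_swap(2)[of a x b y]
    by simp
  finally show ?thesis .
qed

text \<open>The factor \<open>s\<close> carries the sign by which the two lattice directions differ,
  so that one argument serves both.\<close>

lemma wedge_hodge_pairing:
  assumes "wedge f g = s *\<^sub>R hodge (wedge n m)"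
  shows "(f \<bullet> x) * (g \<bullet> y) - (f \<bullet> y) * (g \<bullet> x) = s * det (vector [n, m, x, y] :: real^4^4)"
  using inner_wedge[of x f g y] inner_hodge_wedge[of x n m y]
  by (simp add: assms scaleR_matrix_vector_assoc[symmetric])

lemma orthogonal_basis_eq_0:
  fixes v :: "real^4"
  assumes "det (vector [a, b, c, d] :: real^4^4) \<noteq> 0"
    and "v \<bullet> a = 0" "v \<bullet> b = 0" "v \<bullet> c = 0" "v \<bullet> d = 0"
  shows "v = 0"
proof -
  have "(vector [a, b, c, d] :: real^4^4) *v v = 0"
    using assms by (simp add: vec_eq_iff forall_4 matrix_vector_mul_component vector_4 inner_commute)
  moreover obtain B where "B ** (vector [a, b, c, d] :: real^4^4) = mat 1"
    using assms(1) by (auto simp: invertible_det_nz[symmetric] invertible_def)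
  ultimately show ?thesis
    by (metis matrix_vector_mul_assoc matrix_vector_mul_lid matrix_vector_mult_0_right)
qed

text \<open>A row vector times a matrix is a combination of its rows, so \<open>v v* B\<close>, with
  \<open>B\<close> a left inverse, holds the coefficients.\<close>

lemma basis_expansion:
  fixes v :: "real^4"
  assumes "det (vector [a, b, c, d] :: real^4^4) \<noteq> 0"
  obtains p q r s where "v = p *\<^sub>R a + q *\<^sub>R b + r *\<^sub>R c + s *\<^sub>R d"
proof -
  let ?A = "vector [a, b, c, d] :: real^4^4"
  obtain B where "B ** ?A = mat 1"
    using assms by (auto simp: invertible_det_nz[symmetric] invertible_def)
  then have "(v v* B) v* ?A = v"
    by (simp add: vector_matrix_mul_assoc)
  then have "v = (\<Sum>i\<in>UNIV. (v v* B) $ i *\<^sub>R ?A $ i)"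
    by (simp add: vec_eq_iff vector_matrix_mult_def mult.commute)
  then show thesis
    using that by (simp add: sum_4 vector_4)
qed

text \<open>One lattice square together with the next vertex in the first direction, as plain
  vectors, so that the directions can be exchanged by renaming and replacing \<open>s\<close> by
  \<open>- s\<close>. The edge in \<open>e2\<close> runs in the other direction, hence its
  sign.\<close>

lemma lelieuvre_cell:
  fixes f f1 f12 f11 n n1 n2 n12 n11 :: "real^4"
  defines "A \<equiv> - ((f11 \<bullet> n) / (f12 \<bullet> n))" and "C \<equiv> (f11 \<bullet> n12) / (f12 \<bullet> n)"
  assumes D: "det (vector [n, n1, n2, n12] :: real^4^4) \<noteq> 0" and s: "s \<noteq> 0"
    and e: "wedge f f1 = s *\<^sub>R hodge (wedge n n1)"
    and e2: "wedge f1 f12 = - s *\<^sub>R hodge (wedge n1 n12)"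
    and e1: "wedge f1 f11 = s *\<^sub>R hodge (wedge n1 n11)"
    and orth: "f \<bullet> n = 0" "f \<bullet> n1 = 0" "f \<bullet> n2 = 0"
      "f1 \<bullet> n = 0" "f1 \<bullet> n1 = 0" "f1 \<bullet> n12 = 0" "f1 \<bullet> n11 = 0"
      "f12 \<bullet> n1 = 0" "f12 \<bullet> n2 = 0" "f12 \<bullet> n12 = 0" "f11 \<bullet> n1 = 0"
  shows "f12 \<bullet> n \<noteq> 0"
    and "\<exists>B. n11 = A *\<^sub>R n12 + B *\<^sub>R n1 + C *\<^sub>R n"
    and "\<exists>B. f11 = - A *\<^sub>R f12 + B *\<^sub>R f1 + C *\<^sub>R f"
proof -
  define \<Delta> where "\<Delta> = det (vector [n, n1, n2, n12] :: real^4^4)"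
  have rot: "det (vector [n1, n12, n, n2] :: real^4^4) = - \<Delta>"
    using det_vector_4_swap(2)[of n1 n12 n n2] det_vector_4_swap(1)[of n1 n n12 n2]
      det_vector_4_swap(3)[of n n1 n12 n2]
    by (simp add: \<Delta>_def)
  \<comment> \<open>By orthogonality only one product survives in each of the next two pairings.
    Both products contain \<open>f1 \<bullet> n2\<close> and equal the same nonzero number, which
    gives the nonvanishing and \<open>f12 \<bullet> n = f \<bullet> n12\<close>.\<close>
  have a12: "(f1 \<bullet> n2) * (f12 \<bullet> n) = - s * \<Delta>"
    using wedge_hodge_pairing[OF e2, of n n2] orth rot by simp
  moreover have "(f \<bullet> n12) * (f1 \<bullet> n2) = - s * \<Delta>"
    using wedge_hodge_pairing[OF e, of n2 n12] orth by (simp add: \<Delta>_def)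
  moreover have "s * \<Delta> \<noteq> 0"
    using D s by (simp add: \<Delta>_def)
  ultimately have nz: "f1 \<bullet> n2 \<noteq> 0" "f12 \<bullet> n \<noteq> 0"
    and "(f1 \<bullet> n2) * (f12 \<bullet> n) = (f1 \<bullet> n2) * (f \<bullet> n12)"
    by (auto simp: mult.commute)
  then have a: "f12 \<bullet> n = f \<bullet> n12"
    by simp
  show "f12 \<bullet> n \<noteq> 0" by (rule nz)
  obtain p q r t where n11: "n11 = p *\<^sub>R n + q *\<^sub>R n1 + r *\<^sub>R n2 + t *\<^sub>R n12"
    using basis_expansion[OF D] .
  have r: "r = 0"
    using orth nz unfolding n11 by (simp add: inner_add_right)
  have expand: "det (vector [n1, n11, x, y] :: real^4^4) =
      p * det (vector [n1, n, x, y] :: real^4^4) + t * det (vector [n1, n12, x, y] :: real^4^4)" for x y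
  proof -
    \<comment> \<open>A cyclic move of three entries is even and brings \<open>z\<close> to the slot
      in which linearity is available. The \<open>n1\<close>-component of \<open>n11\<close> then
      repeats a row.\<close>
    have last: "det (vector [n1, z, x, y] :: real^4^4) = det (vector [n1, x, y, z] :: real^4^4)" for z
      using det_vector_4_swap(2)[of n1 z x y] det_vector_4_swap(3)[of n1 x z y] by simp
    show ?thesis
      unfolding last n11 r
      by (simp add: linear_add[OF det_vector_4_linear] linear_cmul[OF det_vector_4_linear]
          det_vector_4_repeated)
  qed
  \<comment> \<open>The \<open>p\<close>-term repeats \<open>n\<close>, which isolates
    \<open>t\<close>; \<open>a12\<close> then turns the determinant into a multiple of
    \<open>f1 \<bullet> n2\<close>, which cancels. The pairing with \<open>n2\<close> and
    \<open>n12\<close> below isolates \<open>p\<close> in the same way.\<close>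
  have "(f1 \<bullet> n2) * (- (f11 \<bullet> n)) = s * t * det (vector [n1, n12, n, n2] :: real^4^4)"
    using wedge_hodge_pairing[OF e1, of n n2] orth det_vector_4_repeated by (simp add: expand)
  also have "\<dots> = (f1 \<bullet> n2) * (t * (f12 \<bullet> n))"
    using a12 rot by (simp add: algebra_simps)
  finally have "- (f11 \<bullet> n) = t * (f12 \<bullet> n)"
    using nz by (simp only: mult_cancel_left) simp
  then have t: "t = A"
    using nz by (simp add: A_def field_simps)
  have "(f1 \<bullet> n2) * (f11 \<bullet> n12) = s * p * det (vector [n1, n, n2, n12] :: real^4^4)"
    using wedge_hodge_pairing[OF e1, of n2 n12] orth det_vector_4_repeated by (simp add: expand)
  also have "\<dots> = (f1 \<bullet> n2) * (p * (f12 \<bullet> n))"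
    using a12 det_vector_4_swap(1)[of n1 n n2 n12] by (simp add: \<Delta>_def algebra_simps)
  finally have p: "p = C"
    using nz by (simp add: C_def field_simps)
  show "\<exists>B. n11 = A *\<^sub>R n12 + B *\<^sub>R n1 + C *\<^sub>R n"
    using n11 by (intro exI[of _ q]) (simp add: r t p)
  \<comment> \<open>Pairing with \<open>n2\<close>, to which \<open>f\<close> and \<open>f12\<close>
    are orthogonal, forces this value. Against \<open>n1\<close> all terms vanish; \<open>n\<close>
    and \<open>n12\<close> are settled by \<open>A\<close> and \<open>C\<close>, the latter through
    \<open>a\<close>.\<close>
  define B where "B = (f11 \<bullet> n2) / (f1 \<bullet> n2)"
  have "f11 - (- A *\<^sub>R f12 + B *\<^sub>R f1 + C *\<^sub>R f) = 0"
    by (rule orthogonal_basis_eq_0[OF D])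
      (use orth nz a in \<open>simp_all add: inner_diff_left inner_add_left A_def B_def C_def\<close>)
  then show "\<exists>B. f11 = - A *\<^sub>R f12 + B *\<^sub>R f1 + C *\<^sub>R f"
    by auto
qed

text \<open>Pairing with \<open>m\<close> and \<open>g\<close> repeats \<open>m\<close> in the
  determinant and leaves \<open>(f \<bullet> m) * (g \<bullet> g) = 0\<close>, where
  \<open>g \<bullet> g\<close> is positive. Pairing with \<open>n\<close> and \<open>f\<close> does
  the same for \<open>g \<bullet> n\<close>.\<close>

lemma lelieuvre_edge:
  fixes f g n m :: "real^4"
  assumes "wedge f g = s *\<^sub>R hodge (wedge n m)"
    and "f \<noteq> 0" "g \<noteq> 0" "f \<bullet> n = 0" "g \<bullet> m = 0"
  shows "f \<bullet> m = 0" "g \<bullet> n = 0"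
proof -
  show "f \<bullet> m = 0"
    using wedge_hodge_pairing[OF assms(1), of m g] assms by (simp add: det_vector_4_repeated)
  show "g \<bullet> n = 0"
    using wedge_hodge_pairing[OF assms(1), of n f] assms by (simp add: det_vector_4_repeated)
qed

theorem theorem5p1:
  fixes f \<nu> :: "int \<Rightarrow> int \<Rightarrow> real^4"
    and A1 A2 C1 C2 :: "int \<Rightarrow> int \<Rightarrow> real"
  assumes "\<forall>n1 n2. f n1 n2 \<noteq> 0"
    and "\<forall>n1 n2. \<nu> n1 n2 \<noteq> 0"
    and "\<forall>n1 n2. f n1 n2 \<bullet> \<nu> n1 n2 = 0"
    and "lelieuvre_related f \<nu>"
    and "\<forall>n1 n2. det (vector [\<nu> n1 n2, shift1 \<nu> n1 n2, shift2 \<nu> n1 n2, shift12 \<nu> n1 n2] :: real^4^4) \<noteq> 0"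
    and "\<forall>n1 n2. A1 n1 n2 = - ((shift11 f n1 n2 \<bullet> \<nu> n1 n2) / (shift12 f n1 n2 \<bullet> \<nu> n1 n2))"
    and "\<forall>n1 n2. C1 n1 n2 = (shift11 f n1 n2 \<bullet> shift12 \<nu> n1 n2) / (shift12 f n1 n2 \<bullet> \<nu> n1 n2)"
    and "\<forall>n1 n2. A2 n1 n2 = - ((shift22 f n1 n2 \<bullet> \<nu> n1 n2) / (shift12 f n1 n2 \<bullet> \<nu> n1 n2))"
    and "\<forall>n1 n2. C2 n1 n2 = (shift22 f n1 n2 \<bullet> shift12 \<nu> n1 n2) / (shift12 f n1 n2 \<bullet> \<nu> n1 n2)"
  shows "(\<forall>n1 n2. shift12 f n1 n2 \<bullet> \<nu> n1 n2 \<noteq> 0) \<and>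
    (\<exists>B1 B2 B1' B2' :: int \<Rightarrow> int \<Rightarrow> real. \<forall>n1 n2.
      shift11 \<nu> n1 n2 = A1 n1 n2 *\<^sub>R shift12 \<nu> n1 n2 + B1 n1 n2 *\<^sub>R shift1 \<nu> n1 n2 + C1 n1 n2 *\<^sub>R \<nu> n1 n2 \<and>
      shift22 \<nu> n1 n2 = A2 n1 n2 *\<^sub>R shift12 \<nu> n1 n2 + B2 n1 n2 *\<^sub>R shift2 \<nu> n1 n2 + C2 n1 n2 *\<^sub>R \<nu> n1 n2 \<and>
      shift11 f n1 n2 = - A1 n1 n2 *\<^sub>R shift12 f n1 n2 + B1' n1 n2 *\<^sub>R shift1 f n1 n2 + C1 n1 n2 *\<^sub>R f n1 n2 \<and>
      shift22 f n1 n2 = - A2 n1 n2 *\<^sub>R shift12 f n1 n2 + B2' n1 n2 *\<^sub>R shift2 f n1 n2 + C2 n1 n2 *\<^sub>R f n1 n2)"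
proof -
  have e1: "wedge (f i j) (f (i + 1) j) = 1 *\<^sub>R hodge (wedge (\<nu> i j) (\<nu> (i + 1) j))"
    and e2: "wedge (f i j) (f i (j + 1)) = -1 *\<^sub>R hodge (wedge (\<nu> i j) (\<nu> i (j + 1)))" for i j
    using assms(4) by (auto simp: lelieuvre_related_def shift1_def shift2_def)
  have nz: "f i j \<noteq> 0" and orth: "f i j \<bullet> \<nu> i j = 0" for i j
    using assms(1,3) by auto
  note edge1 = lelieuvre_edge[OF e1 nz nz orth orth]
  note edge2 = lelieuvre_edge[OF e2 nz nz orth orth]
  have D: "det (vector [\<nu> i j, \<nu> (i + 1) j, \<nu> i (j + 1), \<nu> (i + 1) (j + 1)] :: real^4^4) \<noteq> 0" for i j
    using assms(5) by (simp add: shift1_def shift2_def)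
  have D': "det (vector [\<nu> i j, \<nu> i (j + 1), \<nu> (i + 1) j, \<nu> (i + 1) (j + 1)] :: real^4^4) \<noteq> 0" for i j
    using D[of i j] det_vector_4_swap(2)[of "\<nu> i j" "\<nu> (i + 1) j" "\<nu> i (j + 1)"] by simp
  \<comment> \<open>The factor is written as \<open>- (-1)\<close> to match the \<open>- s\<close>
    in \<open>lelieuvre_cell\<close> for \<open>s = -1\<close>.\<close>
  have e1': "wedge (f i j) (f (i + 1) j) = - (-1) *\<^sub>R hodge (wedge (\<nu> i j) (\<nu> (i + 1) j))" for i j
    using e1 by simp
  \<comment> \<open>The sums \<open>i + 1 + 1\<close> stay unsimplified, since this is the form that
    \<open>e1\<close> and \<open>e2\<close> take at a shifted point.\<close>
  have A1: "A1 i j = - ((f (i + 1 + 1) j \<bullet> \<nu> i j) / (f (i + 1) (j + 1) \<bullet> \<nu> i j))"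
    and C1: "C1 i j = (f (i + 1 + 1) j \<bullet> \<nu> (i + 1) (j + 1)) / (f (i + 1) (j + 1) \<bullet> \<nu> i j)"
    and A2: "A2 i j = - ((f i (j + 1 + 1) \<bullet> \<nu> i j) / (f (i + 1) (j + 1) \<bullet> \<nu> i j))"
    and C2: "C2 i j = (f i (j + 1 + 1) \<bullet> \<nu> (i + 1) (j + 1)) / (f (i + 1) (j + 1) \<bullet> \<nu> i j)"
    for i j
    using assms(6-9) by (simp_all only: shift1_def shift2_def)
  note cell1 = lelieuvre_cell[OF D one_neq_zero e1 e2 e1 orth edge1(1) edge2(1) edge1(2) orth
      edge2(1) edge1(1) edge2(2) edge1(2) orth edge1(2)]
  have "- 1 \<noteq> (0 :: real)" by simp
  \<comment> \<open>The square with its directions exchanged: \<open>s = -1\<close>, the roles of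
    \<open>e1\<close> and \<open>e2\<close> swapped, and \<open>D'\<close> for the reordered
    basis.\<close>
  note cell2 = lelieuvre_cell[OF D' this e2 e1' e2 orth edge2(1) edge1(1) edge2(2) orth
      edge1(1) edge2(1) edge1(2) edge2(2) orth edge2(2)]
  have "\<exists>B. \<nu> (i + 1 + 1) j = A1 i j *\<^sub>R \<nu> (i + 1) (j + 1) + B *\<^sub>R \<nu> (i + 1) j + C1 i j *\<^sub>R \<nu> i j" for i j
    unfolding A1 C1 by (rule cell1(2))
  then obtain B1 where B1:
    "\<And>i j. \<nu> (i + 1 + 1) j = A1 i j *\<^sub>R \<nu> (i + 1) (j + 1) + B1 i j *\<^sub>R \<nu> (i + 1) j + C1 i j *\<^sub>R \<nu> i j"
    by metis
  have "\<exists>B. \<nu> i (j + 1 + 1) = A2 i j *\<^sub>R \<nu> (i + 1) (j + 1) + B *\<^sub>R \<nu> i (j + 1) + C2 i j *\<^sub>R \<nu> i j" for i j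
    unfolding A2 C2 by (rule cell2(2))
  then obtain B2 where B2:
    "\<And>i j. \<nu> i (j + 1 + 1) = A2 i j *\<^sub>R \<nu> (i + 1) (j + 1) + B2 i j *\<^sub>R \<nu> i (j + 1) + C2 i j *\<^sub>R \<nu> i j"
    by metis
  have "\<exists>B. f (i + 1 + 1) j = - A1 i j *\<^sub>R f (i + 1) (j + 1) + B *\<^sub>R f (i + 1) j + C1 i j *\<^sub>R f i j" for i j
    unfolding A1 C1 by (rule cell1(3))
  then obtain B1' where B1':
    "\<And>i j. f (i + 1 + 1) j = - A1 i j *\<^sub>R f (i + 1) (j + 1) + B1' i j *\<^sub>R f (i + 1) j + C1 i j *\<^sub>R f i j"
    by metis
  have "\<exists>B. f i (j + 1 + 1) = - A2 i j *\<^sub>R f (i + 1) (j + 1) + B *\<^sub>R f i (j + 1) + C2 i j *\<^sub>R f i j" for i j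
    unfolding A2 C2 by (rule cell2(3))
  then obtain B2' where B2':
    "\<And>i j. f i (j + 1 + 1) = - A2 i j *\<^sub>R f (i + 1) (j + 1) + B2' i j *\<^sub>R f i (j + 1) + C2 i j *\<^sub>R f i j"
    by metis
  \<comment> \<open>The first conjunct, from \<open>cell1(1)\<close>, ensures that the coefficients
    are genuine quotients and not instances of the convention \<open>x / 0 = 0\<close>.\<close>
  show ?thesis
    unfolding shift1_def shift2_def
    by (intro conjI exI allI) (rule cell1(1) B1 B2 B1' B2')+
qed

end
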